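(* Let $n$ and $k$ be integers with $1\le k\le n-1$, and let $G$ be a connected graph with $n$ vertices and vertex connectivity $\kappa(G)\le k$. Then $$SO(G)\leq k\sqrt{k^{2}+(n-1)^{2}}+k(n-k-1)\sqrt{(n-1)^{2}+(n-2)^{2}}+\frac{\sqrt{2}}{2}k(k-1)(n-1)+\frac{\sqrt{2}}{2}(n-k-1)(n-k-2)(n-2),$$ with equality if and only if $G\cong K_{n}^{k}$.
   Context: All graphs are finite, simple, undirected and connected. For a graph $G$, $d(u)$ denotes the degree of vertex $u$, and the Sombor index is $SO(G)=\sum_{uv\in E(G)}\sqrt{d(u)^{2}+d(v)^{2}}$. A graph $G$ is $k$-connected if $G\cong K_{k+1}$, or $|V(G)|\ge k+2$ and $G$ cannot be disconnected by deleting $k-1$ vertices; $\kappa(G)$ is the largest $k$ such that $G$ is $k$-connected (so $\kappa(G)$ is the usual vertex connectivity, with $\kappa(K_n)=n-1$). $K_m$ denotes the complete graph on $m$ vertices. The graph $K_n^k$ is obtained from the disjoint union of $K_1$, $K_k$ and $K_{n-k-1}$ by adding all edges between $K_1$ and $K_k$ and all edges between $K_k$ and $K_{n-k-1}$ (and no edges between $K_1$ and $K_{n-k-1}$); for $k=n-1$ the part $K_{n-k-1}$ is empty and $K_n^{n-1}\cong K_n$. *)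

theory Defs
  imports Complex_Main "Graph_Theory.Graph_Theory"
begin

text \<open>
  A finite simple undirected graph is a digraph \<open>G\<close> with \<open>graph G\<close>: finite, loop-free, without
  parallel arcs and symmetric, each undirected edge being a pair of opposite arcs. Hence
  \<open>out_degree G u\<close> is the usual degree of \<open>u\<close>.
\<close>

definition undirected_edges :: "('a, 'b) pre_digraph \<Rightarrow> 'a set set" where
  "undirected_edges G = {{u, v} | u v. u \<rightarrow>\<^bsub>G\<^esub> v}"

text \<open>
  As \<open>G\<close> has no loops, an edge \<open>e = {u, v}\<close> has two elements, and the inner sum is
  \<open>d(u)\<^sup>2 + d(v)\<^sup>2\<close>.
\<close>
definition sombor_index :: "('a, 'b) pre_digraph \<Rightarrow> real" where
  "sombor_index G =
     (\<Sum>e\<in>undirected_edges G. sqrt (\<Sum>w\<in>e. (real (out_degree G w))\<^sup>2))"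

text \<open>
  The condition \<open>card S + 1 = k\<close> says that exactly \<open>k - 1\<close> vertices are deleted; it is
  unsatisfiable for \<open>k = 0\<close>, so every graph with at least two vertices is 0-connected. The
  qualified name avoids topological connectedness.
\<close>
definition k_connected :: "nat \<Rightarrow> ('a, 'b) pre_digraph \<Rightarrow> bool" where
  "k_connected k G \<longleftrightarrow>
     complete_digraph (k + 1) G \<or>
     k + 2 \<le> card (verts G) \<and>
     (\<forall>S \<subseteq> verts G. card S + 1 = k \<longrightarrow> Digraph_Component.connected (G \<restriction> (verts G - S)))"

definition vertex_connectivity :: "('a, 'b) pre_digraph \<Rightarrow> nat" where
  "vertex_connectivity G = (GREATEST k. k_connected k G)"

text \<open>
  The graph \<open>K\<^sub>n\<^sup>k\<close>, for \<open>k < n\<close>: the parts \<open>K\<^sub>1\<close>, \<open>K\<^sub>k\<close> and \<open>K\<close> with \<open>n - k - 1\<close> vertices are placed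
  on the vertex sets \<open>A\<close>, \<open>B\<close> and \<open>C\<close>.
\<close>
definition K_graph :: "nat \<Rightarrow> nat \<Rightarrow> (nat, nat \<times> nat) pre_digraph" where
  "K_graph n k =
     (let A = {0}; B = {1..k}; C = {k + 1..<n} in
      with_proj \<lparr>pverts = A \<union> B \<union> C,
        parcs = {(u, v). u \<noteq> v \<and>
          (u, v) \<in> A \<times> A \<union> B \<times> B \<union> C \<times> C \<union> (A \<times> B \<union> B \<times> A) \<union> (B \<times> C \<union> C \<times> B)}\<rparr>)"

end

theory Submission
  imports Defs "HOL-Analysis.Convex"
begin

text \<open>
  A graph of order \<open>n\<close> with connectivity at most \<open>k\<close> has a vertex set \<open>S\<close> of size \<open>k\<close> whose
  removal leaves two nonempty parts \<open>X\<close> and \<open>Y\<close> without edges between them (or \<open>k = n - 1\<close> and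
  \<open>Y\<close> is empty). Adding edges strictly increases the Sombor index, so \<open>G\<close> may be compared
  with the join of \<open>K\<^sub>k\<close> and the disjoint union of two cliques of sizes \<open>a\<close> and \<open>b\<close>. The part of
  the index that depends on \<open>a\<close> and \<open>b\<close> is \<open>a h(a) + b h(b)\<close> with \<open>h\<close> convex and strictly
  increasing, and for a fixed sum \<open>a + b\<close> it is largest exactly when one of the two sizes is \<open>1\<close>.
\<close>

text \<open>Working with the adjacency relation turns adding edges into set inclusion and does away
  with the arc type. The sum runs over ordered pairs, so each undirected edge counts twice.\<close>

definition sombor_rel :: "('a \<times> 'a) set \<Rightarrow> real" where
  "sombor_rel E = (\<Sum>(u, v)\<in>E. sqrt ((real (card (E `` {u})))\<^sup>2 + (real (card (E `` {v})))\<^sup>2))"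

text \<open>Written as a complete graph minus the pairs between \<open>X\<close> and
  \<open>Y\<close>: any loop-free relation on the three sets without such pairs is then visibly
  contained in it.\<close>

definition clique_join :: "'a set \<Rightarrow> 'a set \<Rightarrow> 'a set \<Rightarrow> ('a \<times> 'a) set" where
  "clique_join S X Y =
     {(u, v). u \<in> S \<union> X \<union> Y \<and> v \<in> S \<union> X \<union> Y \<and> u \<noteq> v} - X \<times> Y - Y \<times> X"

section \<open>The Sombor index as a sum over ordered pairs\<close>

lemma (in graph) out_degree_eq_card_Image:
  "out_degree G u = card (arcs_ends G `` {u})"
proof -
  have "arcs_ends G `` {u} = head G ` out_arcs G u"
    by (auto simp: arcs_ends_conv)
  moreover have "inj_on (head G) (out_arcs G u)"
    by (auto intro!: inj_onI no_multi_arcs simp: arc_to_ends_def)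
  ultimately show ?thesis
    by (simp add: out_degree_def card_image)
qed

text \<open>By symmetry and the absence of loops, the map from ordered pairs to edges has fibres of
  exactly two elements, with equal terms.\<close>

lemma (in graph) sombor_rel_eq:
  "sombor_rel (arcs_ends G) = 2 * sombor_index G"
proof -
  let ?E = "arcs_ends G" and ?U = "undirected_edges G"
  let ?f = "\<lambda>p. sqrt ((real (out_degree G (fst p)))\<^sup>2 + (real (out_degree G (snd p)))\<^sup>2)"
  let ?e = "\<lambda>p. {fst p, snd p}"
  have fin: "finite ?E"
    by (simp add: arcs_ends_def)
  have U: "?U = ?e ` ?E"
    by (force simp: undirected_edges_def)
  have "sombor_rel ?E = sum ?f ?E"
    by (simp add: sombor_rel_def out_degree_eq_card_Image case_prod_beta)
  also have "\<dots> = (\<Sum>e\<in>?U. \<Sum>p | p \<in> ?E \<and> ?e p = e. ?f p)"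
    unfolding U by (rule sum.image_gen[OF fin])
  also have "\<dots> = (\<Sum>e\<in>?U. 2 * sqrt (\<Sum>w\<in>e. (real (out_degree G w))\<^sup>2))"
  proof (rule sum.cong[OF refl])
    fix e assume "e \<in> ?U"
    then obtain u v where e: "e = {u, v}" and uv: "(u, v) \<in> ?E"
      by (auto simp: undirected_edges_def)
    have vu: "(v, u) \<in> ?E"
      using uv sym_arcs by (blast intro: arcs_ends_symmetric)
    have ne: "u \<noteq> v"
      using uv adj_not_same by blast
    have "{p. p \<in> ?E \<and> ?e p = e} = {(u, v), (v, u)}"
      using uv vu e by (auto simp: doubleton_eq_iff)
    then show "(\<Sum>p | p \<in> ?E \<and> ?e p = e. ?f p) = 2 * sqrt (\<Sum>w\<in>e. (real (out_degree G w))\<^sup>2)"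
      using ne e by (simp add: add.commute)
  qed
  also have "\<dots> = 2 * sombor_index G"
    by (simp add: sombor_index_def sum_distrib_left)
  finally show ?thesis .
qed

text \<open>Enlarging the relation raises no degree downwards and adds nonnegative terms. A new pair
  \<open>(u, v)\<close> has a positive term, since \<open>u\<close> has positive degree in
  \<open>F\<close>; hence strictness.\<close>

lemma sombor_rel_mono:
  assumes fin: "finite F" and sub: "E \<subseteq> F"
  shows "sombor_rel E \<le> sombor_rel F" and "E \<noteq> F \<Longrightarrow> sombor_rel E < sombor_rel F"
proof -
  let ?f = "\<lambda>E (u, v). sqrt ((real (card (E `` {u})))\<^sup>2 + (real (card (E `` {v})))\<^sup>2)"
  have card_le: "card (E `` {u}) \<le> card (F `` {u})" for u
    using fin sub by (intro card_mono finite_Image) auto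
  have "?f E p \<le> ?f F p" for p
    by (cases p) (auto intro!: real_sqrt_le_mono add_mono power_mono simp: card_le)
  then have 1: "sombor_rel E \<le> sum (?f F) E"
    unfolding sombor_rel_def by (intro sum_mono)
  have 2: "sum (?f F) E \<le> sombor_rel F"
    unfolding sombor_rel_def using fin sub by (intro sum_mono2) auto
  show "sombor_rel E \<le> sombor_rel F"
    using 1 2 by linarith
  assume "E \<noteq> F"
  then obtain u v where uv: "(u, v) \<in> F" "(u, v) \<notin> E"
    using sub by auto
  have "card (F `` {u}) > 0"
    using uv fin by (auto simp: card_gt_0_iff finite_Image)
  then have "?f F (u, v) > 0"
    by (simp add: add_pos_nonneg)
  then have "sum (?f F) E < sombor_rel F"
    unfolding sombor_rel_def
    by (intro sum_strict_mono2[OF fin sub, of "(u, v)"]) (use uv in auto)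
  then show "sombor_rel E < sombor_rel F"
    using 1 by linarith
qed

lemma sombor_rel_map_prod:
  assumes inj: "inj_on h V" and E: "E \<subseteq> V \<times> V"
  shows "sombor_rel (map_prod h h ` E) = sombor_rel E"
proof -
  have deg: "card ((map_prod h h ` E) `` {h u}) = card (E `` {u})" if "u \<in> V" for u
  proof -
    have "(map_prod h h ` E) `` {h u} = h ` (E `` {u})"
      using E inj that by (force dest: inj_onD)
    moreover have "inj_on h (E `` {u})"
      using E by (intro inj_on_subset[OF inj]) auto
    ultimately show ?thesis
      by (simp add: card_image)
  qed
  have "inj_on (map_prod h h) E"
    using map_prod_inj_on[OF inj inj] E by (rule inj_on_subset)
  then show ?thesis
    unfolding sombor_rel_def using E deg
    by (auto simp: sum.reindex intro!: sum.cong)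
qed

section \<open>Joins of a clique with two disjoint cliques\<close>

lemma clique_join_subset: "clique_join S X Y \<subseteq> (S \<union> X \<union> Y) \<times> (S \<union> X \<union> Y)"
  by (auto simp: clique_join_def)

lemma map_prod_clique_join:
  assumes "inj_on h (S \<union> X \<union> Y)"
  shows "map_prod h h ` clique_join S X Y = clique_join (h ` S) (h ` X) (h ` Y)"
proof -
  have mem: "h u \<in> h ` X \<longleftrightarrow> u \<in> X" "h u \<in> h ` Y \<longleftrightarrow> u \<in> Y" if "u \<in> S \<union> X \<union> Y" for u
    using inj_on_image_mem_iff[OF assms that, of X] inj_on_image_mem_iff[OF assms that, of Y] by auto
  have iff: "(h u, h v) \<in> clique_join (h ` S) (h ` X) (h ` Y) \<longleftrightarrow> (u, v) \<in> clique_join S X Y"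
    if "u \<in> S \<union> X \<union> Y" "v \<in> S \<union> X \<union> Y" for u v
    using that inj_on_eq_iff[OF assms that] mem[OF that(1)] mem[OF that(2)]
    by (simp add: clique_join_def flip: image_Un)
  show ?thesis
  proof (intro equalityI subsetI)
    fix p assume "p \<in> map_prod h h ` clique_join S X Y"
    then show "p \<in> clique_join (h ` S) (h ` X) (h ` Y)"
      using clique_join_subset[of S X Y] iff by auto
  next
    fix p assume p: "p \<in> clique_join (h ` S) (h ` X) (h ` Y)"
    then obtain u v where "u \<in> S \<union> X \<union> Y" "v \<in> S \<union> X \<union> Y" "p = (h u, h v)"
      using clique_join_subset[of "h ` S" "h ` X" "h ` Y"] unfolding image_Un[symmetric] by blast
    then show "p \<in> map_prod h h ` clique_join S X Y"
      using iff p by (auto intro!: image_eqI[of _ _ "(u, v)"])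
  qed
qed

lemma clique_join_commute: "clique_join S X Y = clique_join S Y X"
  by (auto simp: clique_join_def)

lemma finite_clique_join:
  assumes "finite S" "finite X" "finite Y"
  shows "finite (clique_join S X Y)"
  by (rule finite_subset[OF clique_join_subset]) (use assms in auto)

text \<open>Vertices in \<open>S\<close>, \<open>X\<close>, \<open>Y\<close> have degrees
  \<open>D\<close>, \<open>s + a - 1\<close>, \<open>s + b - 1\<close>. The factors count ordered
  pairs inside each part and, with the factor 2, between \<open>S\<close> and the other
  parts.\<close>

lemma sombor_rel_clique_join:
  fixes S X Y :: "'a set"
  assumes fin: "finite S" "finite X" "finite Y"
    and disj: "S \<inter> X = {}" "S \<inter> Y = {}" "X \<inter> Y = {}"
  defines "s \<equiv> real (card S)" and "a \<equiv> real (card X)" and "b \<equiv> real (card Y)"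
  defines "r \<equiv> \<lambda>x y::real. sqrt (x\<^sup>2 + y\<^sup>2)"
  defines "D \<equiv> s + a + b - 1"
  shows "sombor_rel (clique_join S X Y) =
    s * (s - 1) * r D D
    + (a * (a - 1) * r (s + a - 1) (s + a - 1) + 2 * s * a * r D (s + a - 1))
    + (b * (b - 1) * r (s + b - 1) (s + b - 1) + 2 * s * b * r D (s + b - 1))"
proof -
  let ?F = "clique_join S X Y"
  let ?d = "\<lambda>u. real (card (?F `` {u}))"
  have imS: "?F `` {u} = (S - {u}) \<union> X \<union> Y" if "u \<in> S" for u
    using that disj by (auto simp: clique_join_def)
  have imX: "?F `` {u} = S \<union> (X - {u})" if "u \<in> X" for u
    using that disj by (auto simp: clique_join_def)
  have imY: "?F `` {u} = S \<union> (Y - {u})" if "u \<in> Y" for u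
    using that disj by (auto simp: clique_join_def)
  \<comment> \<open>Stated over the reals, to keep truncated subtraction out of the degree
    computations.\<close>
  have pred: "real (card (A - {u})) = real (card A) - 1" if "finite A" "u \<in> A" for A :: "'a set" and u
    using that card_Suc_Diff1[of A u] by linarith
  have dj: "(S - {u}) \<inter> X = {}" "(S - {u} \<union> X) \<inter> Y = {}" "S \<inter> (X - {u}) = {}" "S \<inter> (Y - {u}) = {}" for u
    using disj by auto
  have dS: "?d u = D" if "u \<in> S" for u
    unfolding imS[OF that] using that fin dj
    by (simp add: card_Un_disjoint pred D_def s_def a_def b_def del: card_Diff_singleton card_Diff_insert)
  have dX: "?d u = s + a - 1" if "u \<in> X" for u
    unfolding imX[OF that] using that fin dj
    by (simp add: card_Un_disjoint pred s_def a_def del: card_Diff_singleton card_Diff_insert)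
  have dY: "?d u = s + b - 1" if "u \<in> Y" for u
    unfolding imY[OF that] using that fin dj
    by (simp add: card_Un_disjoint pred s_def b_def del: card_Diff_singleton card_Diff_insert)
  have finI: "finite (?F `` {u})" for u
    using fin by (intro finite_Image finite_clique_join)
  have "sombor_rel ?F = (\<Sum>u\<in>S \<union> X \<union> Y. \<Sum>v\<in>?F `` {u}. r (?d u) (?d v))"
  proof -
    have "?F = Sigma (S \<union> X \<union> Y) (\<lambda>u. ?F `` {u})"
      by (auto simp: clique_join_def)
    then have "sombor_rel ?F = (\<Sum>(u, v)\<in>Sigma (S \<union> X \<union> Y) (\<lambda>u. ?F `` {u}). r (?d u) (?d v))"
      unfolding sombor_rel_def r_def by (rule sum.cong) simp
    also have "\<dots> = (\<Sum>u\<in>S \<union> X \<union> Y. \<Sum>v\<in>?F `` {u}. r (?d u) (?d v))"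
      by (rule sum.Sigma[symmetric]) (use fin finI in auto)
    finally show ?thesis .
  qed
  also have "\<dots> = (\<Sum>u\<in>S. \<Sum>v\<in>?F `` {u}. r (?d u) (?d v))
      + (\<Sum>u\<in>X. \<Sum>v\<in>?F `` {u}. r (?d u) (?d v)) + (\<Sum>u\<in>Y. \<Sum>v\<in>?F `` {u}. r (?d u) (?d v))"
  proof -
    have "(S \<union> X) \<inter> Y = {}" using disj by auto
    then show ?thesis using fin disj by (simp add: sum.union_disjoint)
  qed
  also have "(\<Sum>u\<in>S. \<Sum>v\<in>?F `` {u}. r (?d u) (?d v)) =
      s * ((s - 1) * r D D + a * r D (s + a - 1) + b * r D (s + b - 1))"
  proof -
    have "(\<Sum>v\<in>?F `` {u}. r (?d u) (?d v)) =
        (s - 1) * r D D + a * r D (s + a - 1) + b * r D (s + b - 1)" if u: "u \<in> S" for u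
    proof -
      have "(\<Sum>v\<in>?F `` {u}. r (?d u) (?d v)) = (\<Sum>v\<in>(S - {u}) \<union> X \<union> Y. r D (?d v))"
        \<comment> \<open>The order matters: the degree of \<open>u\<close> itself contains the
          neighbourhood that the second unfolding rewrites.\<close>
        unfolding dS[OF u] unfolding imS[OF u] ..
      also have "\<dots> = (\<Sum>v\<in>S - {u}. r D (?d v)) + (\<Sum>v\<in>X. r D (?d v)) + (\<Sum>v\<in>Y. r D (?d v))"
        using fin dj by (simp add: sum.union_disjoint)
      finally show ?thesis
        using u fin by (simp add: dS dX dY pred s_def a_def b_def del: card_Diff_singleton card_Diff_insert)
    qed
    then show ?thesis by (simp add: s_def)
  qed
  also have "(\<Sum>u\<in>X. \<Sum>v\<in>?F `` {u}. r (?d u) (?d v)) =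
      a * (s * r (s + a - 1) D + (a - 1) * r (s + a - 1) (s + a - 1))"
  proof -
    have "(\<Sum>v\<in>?F `` {u}. r (?d u) (?d v)) =
        s * r (s + a - 1) D + (a - 1) * r (s + a - 1) (s + a - 1)" if u: "u \<in> X" for u
    proof -
      have "(\<Sum>v\<in>?F `` {u}. r (?d u) (?d v)) = (\<Sum>v\<in>S \<union> (X - {u}). r (s + a - 1) (?d v))"
        unfolding dX[OF u] unfolding imX[OF u] ..
      also have "\<dots> = (\<Sum>v\<in>S. r (s + a - 1) (?d v)) + (\<Sum>v\<in>X - {u}. r (s + a - 1) (?d v))"
        using fin dj by (simp add: sum.union_disjoint)
      finally show ?thesis
        using u fin by (simp add: dS dX pred s_def a_def del: card_Diff_singleton card_Diff_insert)
    qed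
    then show ?thesis by (simp add: a_def)
  qed
  also have "(\<Sum>u\<in>Y. \<Sum>v\<in>?F `` {u}. r (?d u) (?d v)) =
      b * (s * r (s + b - 1) D + (b - 1) * r (s + b - 1) (s + b - 1))"
  proof -
    have "(\<Sum>v\<in>?F `` {u}. r (?d u) (?d v)) =
        s * r (s + b - 1) D + (b - 1) * r (s + b - 1) (s + b - 1)" if u: "u \<in> Y" for u
    proof -
      have "(\<Sum>v\<in>?F `` {u}. r (?d u) (?d v)) = (\<Sum>v\<in>S \<union> (Y - {u}). r (s + b - 1) (?d v))"
        unfolding dY[OF u] unfolding imY[OF u] ..
      also have "\<dots> = (\<Sum>v\<in>S. r (s + b - 1) (?d v)) + (\<Sum>v\<in>Y - {u}. r (s + b - 1) (?d v))"
        using fin dj by (simp add: sum.union_disjoint)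
      finally show ?thesis
        using u fin by (simp add: dS dY pred s_def b_def del: card_Diff_singleton card_Diff_insert)
    qed
    then show ?thesis by (simp add: b_def)
  qed
  also have "r (s + a - 1) D = r D (s + a - 1)"
    by (simp add: r_def add.commute)
  also have "r (s + b - 1) D = r D (s + b - 1)"
    by (simp add: r_def add.commute)
  finally show ?thesis
    by (simp add: algebra_simps)
qed

section \<open>The optimal sizes of the two cliques\<close>

text \<open>The function is the norm of a complex number depending affinely on \<open>x\<close>, so
  the triangle inequality applies.\<close>

lemma convex_on_sqrt_sum_squares: "convex_on UNIV (\<lambda>x::real. sqrt (c\<^sup>2 + (p + x)\<^sup>2))"
proof -
  have "sqrt (c\<^sup>2 + (p + (u * x + v * y))\<^sup>2)
      \<le> u * sqrt (c\<^sup>2 + (p + x)\<^sup>2) + v * sqrt (c\<^sup>2 + (p + y)\<^sup>2)"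
    if "u \<ge> 0" "v \<ge> 0" "u + v = 1" for u v x y :: real
  proof -
    have u: "u = 1 - v"
      using that by linarith
    have p: "p + (u * x + v * y) = u * (p + x) + v * (p + y)" and c: "c = u * c + v * c"
      unfolding u by (simp_all add: algebra_simps)
    have "Complex c (p + (u * x + v * y)) = u *\<^sub>R Complex c (p + x) + v *\<^sub>R Complex c (p + y)"
      using p c by (simp add: complex_eq_iff)
    then have "norm (Complex c (p + (u * x + v * y))) \<le> u * norm (Complex c (p + x)) + v * norm (Complex c (p + y))"
      using norm_triangle_ineq[of "u *\<^sub>R Complex c (p + x)" "v *\<^sub>R Complex c (p + y)"] that by simp
    then show ?thesis by (simp add: complex_norm)
  qed
  then show ?thesis
    by (simp add: convex_on_def)
qed

text \<open>Both \<open>u\<close> and \<open>v\<close> are convex combinations of \<open>x\<close>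
  and \<open>y\<close>, with the weights \<open>t\<close> and \<open>1 - t\<close> exchanged; adding
  the two convexity inequalities gives the claim.\<close>

lemma convex_on_spread:
  fixes h :: "real \<Rightarrow> real"
  assumes h: "convex_on A h" and "x \<in> A" "y \<in> A" and "x \<le> u" "u \<le> y" and v: "u + v = x + y"
  shows "h u + h v \<le> h x + h y"
proof (cases "x = y")
  case True
  then show ?thesis using assms by auto
next
  case False
  define t where "t = (u - x) / (y - x)"
  have t: "0 \<le> t" "t \<le> 1"
    using assms by (auto simp: t_def divide_simps)
  have "t * (y - x) = u - x"
    using False by (simp add: t_def)
  then have u: "u = (1 - t) * x + t * y"
    by (simp add: algebra_simps)
  have v': "v = (1 - (1 - t)) * x + (1 - t) * y"
    using v u by (simp add: algebra_simps)
  have "h u \<le> (1 - t) * h x + t * h y"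
    using convex_onD[OF h t \<open>x \<in> A\<close> \<open>y \<in> A\<close>] u by simp
  moreover have "h v \<le> t * h x + (1 - t) * h y"
    using convex_onD[OF h, of "1 - t" x y] t assms(2,3) v' by simp
  ultimately show ?thesis by (simp add: algebra_simps)
qed

text \<open>The difference of the two sides splits into \<open>(a - 1) * (h ?t - h a)\<close>,
  controlled by monotonicity, and \<open>b * (h ?t - h b) - (h a - h 1)\<close>, controlled by
  convexity and \<open>1 \<le> b\<close>. The first is positive when both sizes exceed 1.\<close>

lemma mult_convex_spread:
  fixes h :: "real \<Rightarrow> real"
  assumes convex: "convex_on {1..} h" and mono: "strict_mono_on {1..} h" and a: "1 \<le> a" and b: "1 \<le> b"
  shows "a * h a + b * h b \<le> h 1 + (a + b - 1) * h (a + b - 1)"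
    and "1 < a \<Longrightarrow> 1 < b \<Longrightarrow> a * h a + b * h b < h 1 + (a + b - 1) * h (a + b - 1)"
proof -
  let ?t = "a + b - 1"
  have le: "h x \<le> h y" if "1 \<le> x" "x \<le> y" for x y
    using strict_mono_on_leD[OF mono] that by simp
  have spread: "h a + h b \<le> h 1 + h ?t"
    by (rule convex_on_spread[OF convex]) (use a b in auto)
  have "1 * (h a - h 1) \<le> b * (h ?t - h b)"
    using spread b le[of 1 a] a by (intro mult_mono) auto
  moreover have eq: "h 1 + ?t * h ?t - (a * h a + b * h b)
      = (a - 1) * (h ?t - h a) + (b * (h ?t - h b) - 1 * (h a - h 1))"
    by (simp add: algebra_simps)
  moreover have "0 \<le> (a - 1) * (h ?t - h a)"
    using a b le[of a ?t] by simp
  ultimately show "a * h a + b * h b \<le> h 1 + ?t * h ?t"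
    by linarith
  assume "1 < a" "1 < b"
  then have "0 < (a - 1) * (h ?t - h a)"
    using strict_mono_onD[OF mono, of a ?t] by simp
  with \<open>1 * (h a - h 1) \<le> b * (h ?t - h b)\<close> eq
  show "a * h a + b * h b < h 1 + ?t * h ?t"
    by linarith
qed

text \<open>Here \<open>x * h x\<close> is the contribution of a clique of size \<open>x\<close>
  outside \<open>S\<close>, including its edges to \<open>S\<close>; \<open>D\<close> stays constant
  because the total size is fixed. On \<open>{1..}\<close> the first summand is a quadratic and the
  second a multiple of a norm.\<close>

lemma sombor_profile:
  fixes s D :: real
  assumes s: "1 \<le> s"
  defines "h \<equiv> \<lambda>x. (x - 1) * sqrt ((s + x - 1)\<^sup>2 + (s + x - 1)\<^sup>2) + 2 * s * sqrt (D\<^sup>2 + (s + x - 1)\<^sup>2)"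
  shows "convex_on {1..} h" "strict_mono_on {1..} h"
proof -
  have sq: "sqrt ((s + x - 1)\<^sup>2 + (s + x - 1)\<^sup>2) = sqrt 2 * (s + x - 1)" if "x \<ge> 1" for x
    using that s by (simp add: real_sqrt_mult flip: mult_2)
  have h: "h x = (x - 1) * (sqrt 2 * (s + x - 1)) + 2 * s * sqrt (D\<^sup>2 + (s + x - 1)\<^sup>2)" if "x \<ge> 1" for x
    by (simp only: h_def sq[OF that])
  show "strict_mono_on {1..} h"
  proof (rule strict_mono_onI)
    fix x y :: real assume xy: "x \<in> {1..}" "y \<in> {1..}" "x < y"
    have "(x - 1) * (sqrt 2 * (s + x - 1)) \<le> (y - 1) * (sqrt 2 * (s + y - 1))"
      using xy s by (intro mult_mono mult_left_mono) auto
    \<comment> \<open>Strictness is drawn from the edges to \<open>S\<close>, whose weight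
      \<open>2 * s\<close> is positive.\<close>
    moreover have "(s + x - 1)\<^sup>2 < (s + y - 1)\<^sup>2"
      using xy s by (intro power_strict_mono) auto
    then have "2 * s * sqrt (D\<^sup>2 + (s + x - 1)\<^sup>2) < 2 * s * sqrt (D\<^sup>2 + (s + y - 1)\<^sup>2)"
      using s by simp
    moreover have "1 \<le> x" "1 \<le> y"
      using xy by auto
    ultimately show "h x < h y"
      by (simp only: h add_le_less_mono)
  qed
  have "convex_on {1..} (\<lambda>x. sqrt 2 * ((x - 1) * (s + x - 1)) + 2 * s * sqrt (D\<^sup>2 + ((s - 1) + x)\<^sup>2))"
  proof (intro convex_on_add convex_on_cmul)
    show "convex_on {1..} (\<lambda>x. (x - 1) * (s + x - 1))"
    proof (rule f''_ge0_imp_convex)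
      show "((\<lambda>x. (x - 1) * (s + x - 1)) has_real_derivative (2 * x + s - 2)) (at x)" for x
        by (auto intro!: derivative_eq_intros)
      show "((\<lambda>x. 2 * x + s - 2) has_real_derivative 2) (at x)" for x
        by (auto intro!: derivative_eq_intros)
    qed auto
    show "convex_on {1..} (\<lambda>x. sqrt (D\<^sup>2 + ((s - 1) + x)\<^sup>2))"
      by (rule convex_on_subset[OF convex_on_sqrt_sum_squares]) auto
  qed (use s in auto)
  moreover have "h x = sqrt 2 * ((x - 1) * (s + x - 1)) + 2 * s * sqrt (D\<^sup>2 + ((s - 1) + x)\<^sup>2)"
    if "x \<in> {1..}" for x
    using that by (simp add: h algebra_simps)
  \<comment> \<open>Agreement on \<open>{1..}\<close> suffices, as this set is closed under convex
    combinations.\<close>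
  ultimately show "convex_on {1..} h"
    unfolding convex_on_def by (metis convexD)
qed

text \<open>The edges inside \<open>S\<close> contribute an amount fixed by \<open>k\<close> and
  \<open>n\<close>; the rest is \<open>a * h a + b * h b\<close>, which is compared with the sizes
  \<open>1\<close> and \<open>n - k - 1\<close>. An empty \<open>Y\<close> covers
  \<open>k = n - 1\<close>.\<close>

lemma sombor_rel_clique_join_le:
  fixes S X Y :: "'a set"
  assumes fin: "finite S" "finite X" "finite Y"
    and disj: "S \<inter> X = {}" "S \<inter> Y = {}" "X \<inter> Y = {}"
    and "S \<noteq> {}" and X: "X \<noteq> {}" and Y: "Y = {} \<Longrightarrow> card X = 1"
    and k: "card S = k" and n: "card (S \<union> X \<union> Y) = n"
  defines "bound \<equiv>
      real k * sqrt ((real k)\<^sup>2 + (real n - 1)\<^sup>2)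
      + real k * (real n - real k - 1) * sqrt ((real n - 1)\<^sup>2 + (real n - 2)\<^sup>2)
      + sqrt 2 / 2 * real k * (real k - 1) * (real n - 1)
      + sqrt 2 / 2 * (real n - real k - 1) * (real n - real k - 2) * (real n - 2)"
  shows "sombor_rel (clique_join S X Y) \<le> 2 * bound"
    and "sombor_rel (clique_join S X Y) = 2 * bound \<longleftrightarrow> card X = 1 \<or> card Y = 1"
proof -
  define s a b where "s = real (card S)" and "a = real (card X)" and "b = real (card Y)"
  define D where "D = s + a + b - 1"
  define h where "h \<equiv> \<lambda>x. (x - 1) * sqrt ((s + x - 1)\<^sup>2 + (s + x - 1)\<^sup>2) + 2 * s * sqrt (D\<^sup>2 + (s + x - 1)\<^sup>2)"
  have s: "1 \<le> s" and a: "1 \<le> a" and b: "b = 0 \<or> 1 \<le> b" "b = 0 \<Longrightarrow> a = 1"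
    using assms by (auto simp: s_def a_def b_def Suc_le_eq card_gt_0_iff)
  have "(S \<union> X) \<inter> Y = {}" using disj by auto
  then have n': "real n = s + a + b" and k': "real k = s"
    using n k fin disj by (simp_all add: card_Un_disjoint s_def a_def b_def flip: n)
  have rr: "sqrt (x\<^sup>2 + x\<^sup>2) = sqrt 2 * x" if "x \<ge> 0" for x :: real
    using that by (simp add: real_sqrt_mult flip: mult_2)
  have D: "sqrt (D\<^sup>2 + D\<^sup>2) = sqrt 2 * D"
    using s a b by (intro rr) (auto simp: D_def)
  \<comment> \<open>In the extremal graph the single vertex has degree \<open>s\<close>, and the
    vertices of the other clique have degree \<open>D - 1\<close>, that is
    \<open>n - 2\<close>.\<close>
  have h1: "h 1 = 2 * s * sqrt (s\<^sup>2 + D\<^sup>2)"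
    by (simp add: h_def add.commute)
  have ht: "h (a + b - 1) = (a + b - 2) * (sqrt 2 * (D - 1)) + 2 * s * sqrt (D\<^sup>2 + (D - 1)\<^sup>2)"
  proof -
    have "s + (a + b - 1) - 1 = D - 1" by (simp add: D_def)
    moreover have "sqrt ((D - 1)\<^sup>2 + (D - 1)\<^sup>2) = sqrt 2 * (D - 1)"
      using s a b by (intro rr) (auto simp: D_def)
    ultimately show ?thesis by (simp add: h_def)
  qed
  have val: "sombor_rel (clique_join S X Y) = s * (s - 1) * (sqrt 2 * D) + (a * h a + b * h b)"
    unfolding sombor_rel_clique_join[OF fin disj]
    unfolding s_def[symmetric] a_def[symmetric] b_def[symmetric] D_def[symmetric] D h_def
    by (simp add: algebra_simps)
  have bd: "2 * bound = s * (s - 1) * (sqrt 2 * D) + (h 1 + (a + b - 1) * h (a + b - 1))"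
  proof -
    have "real n - 1 = D" "real n - 2 = D - 1" "real n - s - 1 = a + b - 1" "real n - s - 2 = a + b - 2"
      by (auto simp: n' D_def)
    then have bound: "bound = s * sqrt (s\<^sup>2 + D\<^sup>2) + s * (a + b - 1) * sqrt (D\<^sup>2 + (D - 1)\<^sup>2)
        + sqrt 2 / 2 * s * (s - 1) * D + sqrt 2 / 2 * (a + b - 1) * (a + b - 2) * (D - 1)"
      unfolding bound_def k' by (simp only:)
    show ?thesis
      unfolding bound h1 ht by (simp add: field_simps)
  qed
  have conv: "convex_on {1..} h" "strict_mono_on {1..} h"
    unfolding h_def by (rule sombor_profile[OF s])+
  \<comment> \<open>If \<open>b = 0\<close>, then \<open>a = 1\<close> and both sides are
    \<open>h 1\<close>.\<close>
  have "a * h a + b * h b \<le> h 1 + (a + b - 1) * h (a + b - 1)"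
    using mult_convex_spread(1)[OF conv a] b by fastforce
  then show "sombor_rel (clique_join S X Y) \<le> 2 * bound"
    using val bd by linarith
  have "a * h a + b * h b = h 1 + (a + b - 1) * h (a + b - 1) \<longleftrightarrow> a = 1 \<or> b = 1"
    using mult_convex_spread(2)[OF conv a] a b by fastforce
  then show "sombor_rel (clique_join S X Y) = 2 * bound \<longleftrightarrow> card X = 1 \<or> card Y = 1"
    using val bd by (auto simp: a_def b_def)
qed

section \<open>Small vertex cuts\<close>

text \<open>Take for \<open>X\<close> all vertices reachable from some \<open>u\<close> that does
  not reach every vertex. No arc leaves \<open>X\<close>, and by symmetry none enters it.\<close>

lemma (in sym_digraph) not_connected_partition:
  assumes "\<not> Digraph_Component.connected G" "verts G \<noteq> {}"
  obtains X Y where "verts G = X \<union> Y" "X \<inter> Y = {}" "X \<noteq> {}" "Y \<noteq> {}"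
    "arcs_ends G \<inter> X \<times> Y = {}" "arcs_ends G \<inter> Y \<times> X = {}"
proof -
  have "\<not> strongly_connected G"
    using assms(1) reachable_mk_symmetricI by (auto simp: connected_def strongly_connected_def)
  then obtain u v where uv: "u \<in> verts G" "v \<in> verts G" "\<not> u \<rightarrow>\<^sup>* v"
    using assms(2) by (auto simp: strongly_connected_def)
  define X where "X = {w \<in> verts G. u \<rightarrow>\<^sup>* w}"
  have cut: "arcs_ends G \<inter> X \<times> (verts G - X) = {}"
    by (auto simp: X_def dest: reachable_adj_trans)
  show thesis
  proof (rule that)
    show "verts G = X \<union> (verts G - X)" "X \<inter> (verts G - X) = {}" "X \<noteq> {}" "verts G - X \<noteq> {}"
      using uv by (auto simp: X_def)
    show "arcs_ends G \<inter> X \<times> (verts G - X) = {}"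
      by (rule cut)
    then show "arcs_ends G \<inter> (verts G - X) \<times> X = {}"
      using sym_arcs by (auto dest: arcs_ends_symmetric)
  qed
qed

text \<open>\<open>GREATEST\<close> is meaningful because both alternatives of
  \<open>k_connected\<close> bound \<open>k\<close> by the number of vertices.\<close>

lemma (in graph) k_connected_le_vertex_connectivity:
  assumes "k_connected k G"
  shows "k \<le> vertex_connectivity G"
  unfolding vertex_connectivity_def
  by (rule Greatest_le_nat[where b = "card (verts G)"])
    (use assms in \<open>auto simp: k_connected_def complete_digraph_def\<close>)

lemma (in graph) vertex_cut:
  assumes kap: "vertex_connectivity G \<le> k" and k: "1 \<le> k" "k \<le> card (verts G) - 1"
  obtains S X Y where "verts G = S \<union> X \<union> Y" "S \<inter> X = {}" "S \<inter> Y = {}" "X \<inter> Y = {}"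
    "card S = k" "X \<noteq> {}" "Y = {} \<Longrightarrow> card X = 1" "arcs_ends G \<subseteq> clique_join S X Y"
proof -
  have E: "arcs_ends G \<subseteq> {(u, v). u \<in> verts G \<and> v \<in> verts G \<and> u \<noteq> v}"
    using adj_in_verts adj_not_same by blast
  have nk: "\<not> k_connected (Suc k) G"
    using k_connected_le_vertex_connectivity kap by fastforce
  consider "k = card (verts G) - 1" | "k + 2 = card (verts G)" | "k + 3 \<le> card (verts G)"
    using k by linarith
  then show thesis
  proof cases
    case 1
    then obtain x where x: "x \<in> verts G"
      using k by (metis card.empty diff_0_eq_0 ex_in_conv not_one_le_zero)
    show thesis
      by (rule that[of "verts G - {x}" "{x}" "{}"]) (use 1 x E in \<open>auto simp: clique_join_def\<close>)
  next
    case 2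
    have "arcs_ends G \<noteq> {(u, v). (u, v) \<in> verts G \<times> verts G \<and> u \<noteq> v}"
      using nk 2 graph_axioms by (auto simp: k_connected_def complete_digraph_def)
    then obtain x y where xy: "x \<in> verts G" "y \<in> verts G" "x \<noteq> y" "(x, y) \<notin> arcs_ends G"
      using E by auto
    have yx: "(y, x) \<notin> arcs_ends G"
      using xy(4) sym_arcs by (blast dest: arcs_ends_symmetric)
    have "card (verts G - {x, y}) = k"
      using xy 2 by (simp add: card_Diff_subset)
    then show thesis
      by (intro that[of "verts G - {x, y}" "{x}" "{y}"])
        (use xy yx E in \<open>auto simp: clique_join_def\<close>)
  next
    case 3
    then obtain S where S: "S \<subseteq> verts G" "card S = k"
      and nc: "\<not> Digraph_Component.connected (G \<restriction> (verts G - S))"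
      using nk by (auto simp: k_connected_def)
    interpret H: sym_digraph "G \<restriction> (verts G - S)"
      by (rule induced_graph_imp_graph) (rule induced_induce, blast)
    have "card (verts G - S) \<noteq> 0"
      using S 3 finite_subset[OF S(1)] by (simp add: card_Diff_subset)
    then have "verts (G \<restriction> (verts G - S)) \<noteq> {}"
      by (metis card.empty induce_subgraph_verts)
    from H.not_connected_partition[OF nc this] obtain X Y
      where XY: "verts G - S = X \<union> Y" "X \<inter> Y = {}" "X \<noteq> {}" "Y \<noteq> {}"
        and cut: "arcs_ends (G \<restriction> (verts G - S)) \<inter> X \<times> Y = {}"
          "arcs_ends (G \<restriction> (verts G - S)) \<inter> Y \<times> X = {}"
      by auto
    \<comment> \<open>The induced subgraph keeps every arc with both ends outside \<open>S\<close>,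
      so the absence of arcs between \<open>X\<close> and \<open>Y\<close> carries over to
      \<open>G\<close>.\<close>
    have ends: "(u, v) \<in> arcs_ends (G \<restriction> (verts G - S))"
      if "(u, v) \<in> arcs_ends G" "u \<in> verts G - S" "v \<in> verts G - S" for u v
      using that by (auto simp: arcs_ends_conv induce_subgraph_def)
    have "arcs_ends G \<inter> X \<times> Y = {}" "arcs_ends G \<inter> Y \<times> X = {}"
      using cut ends XY(1) by blast+
    moreover have "verts G = S \<union> X \<union> Y"
      using S XY by auto
    ultimately show thesis
      by (intro that[of S X Y]) (use S XY E in \<open>auto simp: clique_join_def\<close>)
  qed
qed

section \<open>Isomorphism with \<open>K\<^sub>n\<^sup>k\<close>\<close>

lemma K_graph_eq:
  assumes "k < n"
  shows "K_graph n k = with_proj \<lparr>pverts = {0..<n}, parcs = clique_join {1..k} {0} {k + 1..<n}\<rparr>"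
proof -
  have "{0} \<union> {1..k} \<union> {k + 1..<n} = {0..<n}"
    using assms by auto
  moreover have "{(u, v). u \<noteq> v \<and>
      (u, v) \<in> {0} \<times> {0} \<union> {1..k} \<times> {1..k} \<union> {k + 1..<n} \<times> {k + 1..<n}
        \<union> ({0} \<times> {1..k} \<union> {1..k} \<times> {0}) \<union> ({1..k} \<times> {k + 1..<n} \<union> {k + 1..<n} \<times> {1..k})}
      = clique_join {1..k} {0} {k + 1..<n}"
    by (auto simp: clique_join_def)
  ultimately show ?thesis
    by (simp only: K_graph_def Let_def)
qed

text \<open>Without parallel arcs an arc is determined by its ends, so an injective vertex map
  induces an injective arc map.\<close>

lemma (in graph) digraph_iso_with_projI:
  assumes "inj_on h (verts G)"
  shows "digraph_iso G (with_proj \<lparr>pverts = h ` verts G, parcs = map_prod h h ` arcs_ends G\<rparr>)"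
proof -
  let ?f = "\<lparr>iso_verts = h, iso_arcs = map_prod h h \<circ> arc_to_ends G, iso_head = snd, iso_tail = fst\<rparr>"
  have "inj_on (map_prod h h) (arc_to_ends G ` arcs G)"
    by (rule inj_on_subset[OF map_prod_inj_on[OF assms assms]]) (auto simp: arc_to_ends_def)
  then have "inj_on (map_prod h h \<circ> arc_to_ends G) (arcs G)"
    using inj_on_arc_to_ends by (intro comp_inj_on)
  then have "digraph_isomorphism ?f"
    using assms wf_digraph by (auto simp: digraph_isomorphism_def arc_to_ends_def)
  moreover have "with_proj \<lparr>pverts = h ` verts G, parcs = map_prod h h ` arcs_ends G\<rparr> = app_iso ?f G"
    by (simp add: with_proj_def app_iso_def arcs_ends_def image_comp)
  ultimately show ?thesis
    unfolding digraph_iso_def by blast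
qed

text \<open>Bijections from \<open>S\<close> and \<open>Y\<close> to the matching intervals are
  glued, with \<open>x\<close> sent to \<open>0\<close>.\<close>

lemma (in graph) digraph_iso_K_graph:
  assumes V: "verts G = S \<union> {x} \<union> Y" and disj: "x \<notin> S" "S \<inter> Y = {}" "x \<notin> Y"
    and E: "arcs_ends G = clique_join S {x} Y"
  shows "digraph_iso G (K_graph (card (verts G)) (card S))"
proof -
  let ?n = "card (verts G)" and ?k = "card S"
  have fin: "finite S" "finite Y"
    using finite_verts unfolding V by auto
  have n: "?n = Suc (?k + card Y)"
    unfolding V using fin disj by (simp add: card_Un_disjoint)
  obtain f where f: "bij_betw f S {1..?k}"
    using fin finite_same_card_bij[of S "{1..?k}"] by auto
  obtain g where g: "bij_betw g Y {?k + 1..<?n}"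
    using finite_same_card_bij[OF fin(2) finite_atLeastLessThan, of "?k + 1" ?n] by (auto simp: n)
  define h where "h u = (if u = x then 0 else if u \<in> S then f u else g u)" for u
  have hS: "h ` S = {1..?k}"
  proof -
    have "h ` S = f ` S"
      using disj by (intro image_cong) (auto simp: h_def)
    then show ?thesis using f by (simp add: bij_betw_def)
  qed
  have hY: "h ` Y = {?k + 1..<?n}"
  proof -
    have "h ` Y = g ` Y"
      using disj by (intro image_cong) (auto simp: h_def)
    then show ?thesis using g by (simp add: bij_betw_def)
  qed
  have hx: "h x = 0" by (simp add: h_def)
  have im: "h ` verts G = {0..<?n}"
    using n by (auto simp: V image_Un hS hY hx)
  \<comment> \<open>The image has as many elements as the domain.\<close>
  then have inj: "inj_on h (verts G)"
    by (simp add: eq_card_imp_inj_on)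
  have "map_prod h h ` arcs_ends G = clique_join {1..?k} {0} {?k + 1..<?n}"
    using map_prod_clique_join[of h S "{x}" Y] inj by (simp add: E V hS hY hx)
  moreover have "?k < ?n"
    using n by simp
  ultimately show ?thesis
    using digraph_iso_with_projI[OF inj] im by (simp add: K_graph_eq)
qed

section \<open>The upper bound for the Sombor index and its equality case\<close>

theorem theorem2p6:
  fixes G :: "('a, 'b) pre_digraph" and n k :: nat
  assumes "1 \<le> k" and "k \<le> n - 1"
    and "graph G" and "Digraph_Component.connected G"
    and "card (verts G) = n"
    and "vertex_connectivity G \<le> k"
  defines "bound \<equiv>
      real k * sqrt ((real k)\<^sup>2 + (real n - 1)\<^sup>2)
      + real k * (real n - real k - 1) * sqrt ((real n - 1)\<^sup>2 + (real n - 2)\<^sup>2)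
      + sqrt 2 / 2 * real k * (real k - 1) * (real n - 1)
      + sqrt 2 / 2 * (real n - real k - 1) * (real n - real k - 2) * (real n - 2)"
  shows "sombor_index G \<le> bound \<and> (sombor_index G = bound \<longleftrightarrow> digraph_iso G (K_graph n k))"
proof -
  interpret graph G by fact
  obtain S X Y where V: "verts G = S \<union> X \<union> Y"
    and disj: "S \<inter> X = {}" "S \<inter> Y = {}" "X \<inter> Y = {}"
    and S: "card S = k" and X: "X \<noteq> {}" and Y: "Y = {} \<Longrightarrow> card X = 1"
    and E: "arcs_ends G \<subseteq> clique_join S X Y"
    using vertex_cut[of k] assms by metis
  have fin: "finite S" "finite X" "finite Y"
    using finite_verts unfolding V by auto
  have "S \<noteq> {}"
    using S assms(1) by auto
  note opt = sombor_rel_clique_join_le[OF fin disj \<open>S \<noteq> {}\<close> X Y S assms(5)[unfolded V], folded bound_def]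
  note mono = sombor_rel_mono[OF finite_clique_join[OF fin] E]
  have le: "sombor_index G \<le> bound"
    using opt(1) mono(1) sombor_rel_eq by linarith
  have "digraph_iso G (K_graph n k)" if "sombor_index G = bound"
  proof -
    \<comment> \<open>Equality makes both links of the chain tight: no edge can be added, and one of
      the two cliques is a single vertex.\<close>
    have "sombor_rel (arcs_ends G) = sombor_rel (clique_join S X Y)"
      and "sombor_rel (clique_join S X Y) = 2 * bound"
      using that opt(1) mono(1) sombor_rel_eq by linarith+
    then have eq: "arcs_ends G = clique_join S X Y" and "card X = 1 \<or> card Y = 1"
      using opt(2) mono(2) by fastforce+
    from this(2) show ?thesis
    proof
      assume "card X = 1"
      then obtain x where "X = {x}"
        by (auto simp: card_1_singleton_iff)
      then show ?thesis
        using digraph_iso_K_graph[of S x Y] V disj eq S assms(5) by auto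
    next
      assume "card Y = 1"
      then obtain y where "Y = {y}"
        by (auto simp: card_1_singleton_iff)
      then show ?thesis
        using digraph_iso_K_graph[of S y X] V disj eq S assms(5)
        by (auto simp: clique_join_commute[of S X] Un_ac)
    qed
  qed
  moreover have "sombor_index G = bound" if iso: "digraph_iso G (K_graph n k)"
  proof -
    have kn: "k < n"
      using assms(1,2) by linarith
    let ?F = "clique_join {1..k} {0} {k + 1..<n}"
    obtain f where f: "digraph_isomorphism f" and K: "K_graph n k = app_iso f G"
      using iso by (auto simp: digraph_iso_def)
    \<comment> \<open>Relabelling preserves \<open>sombor_rel\<close>, so it is enough to evaluate
      it on \<open>K_graph n k\<close>, where the part \<open>{0}\<close> is a single vertex and the
      equality clause applies.\<close>
    have "?F = arcs_ends (app_iso f G)"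
      using kn by (simp add: K_graph_eq flip: K)
    also have "\<dots> = map_prod (iso_verts f) (iso_verts f) ` arcs_ends G"
      using f by (simp add: arcs_ends_app_iso_eq map_prod_def)
    finally have "sombor_rel ?F = sombor_rel (arcs_ends G)"
      using digraph_isomorphism_inj_on_verts[OF f] adj_in_verts
      by (simp add: sombor_rel_map_prod[of _ "verts G"] subset_iff)
    moreover have "{1..k} \<union> {0} \<union> {k + 1..<n} = {0..<n}"
      using kn by auto
    then have "sombor_rel ?F = 2 * bound"
      unfolding bound_def
      by (subst sombor_rel_clique_join_le(2)) (use assms(1) in auto)
    ultimately show ?thesis
      using sombor_rel_eq by linarith
  qed
  ultimately show ?thesis
    using le by blast
qed

end
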